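(* Let $k\ge 3$ be a fixed integer and let $$U_k(x)=\sum_{\substack{n_1,\ldots,n_k\le x\\ (n_1,\ldots,n_k)=1}}\frac{1}{[n_1,\ldots,n_k]}.$$ Then $U_k(x)\asymp(\log x)^{2^k-2}$ as $x\to\infty$, i.e. there are constants $c_1,c_2>0$ (depending on $k$) with $c_1(\log x)^{2^k-2}\le U_k(x)\le c_2(\log x)^{2^k-2}$ for all sufficiently large $x$.
   Context: $(n_1,\ldots,n_k)$ and $[n_1,\ldots,n_k]$ denote the greatest common divisor and least common multiple of the positive integers $n_1,\ldots,n_k$; the sum ranges over $k$-tuples of positive integers $\le x$. *)

theory Defs
  imports Complex_Main "HOL-Library.FuncSet"
begin

text \<open>
  A \<open>k\<close>-tuple \<open>(n\<^sub>1, \<dots>, n\<^sub>k)\<close> is an extensional function on the index set \<open>{1..k}\<close>, so that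
  distinct tuples are distinct functions and the sum below ranges over a finite set.
\<close>

definition pos_tuples_le :: "nat \<Rightarrow> real \<Rightarrow> (nat \<Rightarrow> nat) set" where
  "pos_tuples_le k x = {1..k} \<rightarrow>\<^sub>E {m. 0 < m \<and> real m \<le> x}"

definition U :: "nat \<Rightarrow> real \<Rightarrow> real" where
  "U k x = (\<Sum>n | n \<in> pos_tuples_le k x \<and> Gcd (n ` {1..k}) = 1. 1 / real (Lcm (n ` {1..k})))"

lemma finite_pos_tuples_le: "finite (pos_tuples_le k x)"
proof -
  have "{m. 0 < m \<and> real m \<le> x} \<subseteq> {..nat \<lfloor>x\<rfloor>}"
    by (auto simp: le_nat_floor)
  then have "finite {m. 0 < m \<and> real m \<le> x}"
    by (rule finite_subset) simp
  then show ?thesis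
    unfolding pos_tuples_le_def by (intro finite_PiE) auto
qed

end

theory Submission
  imports Defs "HOL-Analysis.Harmonic_Numbers" "HOL-Computational_Algebra.Primes"
begin

text \<open>
  Sorting the prime powers of \<open>n\<^sub>1, \<dots>, n\<^sub>k\<close> by the set of indices they divide writes
  \<open>n\<^sub>i = (\<Prod>S \<ni> i. d\<^sub>S)\<close> with \<open>[n\<^sub>1, \<dots>, n\<^sub>k] = (\<Prod>S. d\<^sub>S)\<close>, where \<open>S\<close> ranges over the nonempty
  sets of indices; a gcd of \<open>1\<close> forces \<open>d\<^sub>S = 1\<close> for the full set, leaving \<open>m = 2\<^sup>k - 2\<close>
  parameters \<open>d\<^sub>S \<le> x\<close>. So \<open>U\<^sub>k(x)\<close> is at most the \<open>m\<close>-th power of a harmonic sum.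

  Conversely, pairwise coprime \<open>d\<^sub>S \<le> x\<^bsup>1/m\<^esup>\<close> yield distinct admissible tuples. Take the \<open>d\<^sub>S\<close>
  coprime to \<open>Q = (2m\<^sup>2)!\<close>: the sum \<open>T\<close> of their reciprocals is still of order \<open>log x\<close>, and since a
  common factor \<open>n\<close> of two of them exceeds \<open>2m\<^sup>2\<close>, the families that are not pairwise coprime
  contribute at most \<open>m\<^sup>2 T\<^sup>m \<Sum>n>2m\<^sup>2. 1/n\<^sup>2 \<le> T\<^sup>m / 2\<close>.
\<close>

section \<open>Venn parametrisation of tuples by sets of indices\<close>

definition proper_parts :: "'a set \<Rightarrow> 'a set set" where
  "proper_parts K = Pow K - {{}, K}"

definition venn_prod :: "'a set set \<Rightarrow> ('a set \<Rightarrow> nat) \<Rightarrow> 'a \<Rightarrow> nat" where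
  "venn_prod P d i = (\<Prod>S | S \<in> P \<and> i \<in> S. d S)"

lemma finite_proper_parts: "finite K \<Longrightarrow> finite (proper_parts K)"
  by (simp add: proper_parts_def)

lemma card_proper_parts:
  assumes "finite K" "K \<noteq> {}"
  shows "card (proper_parts K) = 2 ^ card K - 2"
  using assms unfolding proper_parts_def
  by (subst card_Diff_subset) (auto simp: card_Pow card_insert_if)

lemma dvd_venn_prod: "finite P \<Longrightarrow> S \<in> P \<Longrightarrow> i \<in> S \<Longrightarrow> d S dvd venn_prod P d i"
  unfolding venn_prod_def by (intro dvd_prodI) auto

lemma prime_dvd_venn_prod:
  assumes "finite P" "prime p"
  shows "p dvd venn_prod P d i \<longleftrightarrow> (\<exists>S\<in>P. i \<in> S \<and> p dvd d S)"
  using assms unfolding venn_prod_def by (subst prime_dvd_prod_iff) auto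

subsection \<open>Upper bound\<close>

text \<open>Induction on the product of the \<open>n i\<close>: take a prime \<open>p\<close>
  dividing some entry, divide every entry divisible by \<open>p\<close> by one copy of it, and
  multiply that copy into the parameter of the set \<open>S0\<close> of affected indices. This keeps
  the product of all parameters a divisor of the lcm.\<close>

lemma exists_venn_factorization:
  fixes n :: "'a \<Rightarrow> nat"
  assumes "finite K" and "\<And>i. i \<in> K \<Longrightarrow> n i > 0"
  shows "\<exists>d. (\<forall>S. d S > 0) \<and> (\<forall>i\<in>K. n i = venn_prod (Pow K - {{}}) d i)
           \<and> (\<Prod>S\<in>Pow K - {{}}. d S) dvd Lcm (n ` K)"
  using assms(2)
proof (induction "\<Prod>i\<in>K. n i" arbitrary: n rule: less_induct)
  case less
  show ?case
  proof (cases "\<forall>i\<in>K. n i = 1")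
    case True
    then show ?thesis
      by (intro exI[of _ "\<lambda>_. 1"]) (auto simp: venn_prod_def)
  next
    case False
    then obtain i0 where i0: "i0 \<in> K" "n i0 \<noteq> 1" by auto
    then obtain p where p: "prime p" "p dvd n i0" using prime_factor_nat by blast
    define S0 where "S0 = {i \<in> K. p dvd n i}"
    define n' where "n' i = (if i \<in> S0 then n i div p else n i)" for i
    have p1: "p > 1" using p(1) prime_gt_1_nat by blast
    have S0: "S0 \<in> Pow K - {{}}" "i0 \<in> S0" using i0 p by (auto simp: S0_def)
    have n: "n i = (if i \<in> S0 then p * n' i else n' i)" for i
      by (auto simp: n'_def S0_def)
    have n'_pos: "n' i > 0" if "i \<in> K" for i
      using less.prems[OF that] n[of i] by (cases "i \<in> S0") auto
    have "(\<Prod>i\<in>K. n' i) < (\<Prod>i\<in>K. n i)"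
    proof (rule prod_mono_strict[of i0])
      show "n' i0 < n i0" using n[of i0] S0 p1 n'_pos[OF i0(1)] by simp
      show "0 \<le> n' i \<and> n' i \<le> n i" for i using n[of i] p1 by simp
    qed (use i0 assms(1) less.prems in auto)
    from less.hyps[OF this n'_pos] obtain d where d: "\<forall>S. d S > 0"
      "\<forall>i\<in>K. n' i = venn_prod (Pow K - {{}}) d i"
      "(\<Prod>S\<in>Pow K - {{}}. d S) dvd Lcm (n' ` K)" by auto
    define d' where "d' = d(S0 := p * d S0)"
    \<comment> \<open>Stated for arbitrary \<open>A\<close> so that it covers both the full product
      and each \<open>venn_prod\<close>, whose family of sets contains \<open>S0\<close> exactly
      when \<open>i\<close> lies in \<open>S0\<close>.\<close>
    have upd: "(\<Prod>S\<in>A. d' S) = (if S0 \<in> A then p else 1) * (\<Prod>S\<in>A. d S)" if "finite A" for A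
    proof (cases "S0 \<in> A")
      case True
      then show ?thesis using that by (simp add: prod.remove[of A S0] d'_def)
    next
      case False
      then show ?thesis by (auto simp: d'_def intro!: prod.cong)
    qed
    have "p * Lcm (n' ` K) dvd Lcm (n ` K)"
    proof -
      have "p dvd Lcm (n ` K)" using p(2) i0(1) by (meson dvd_Lcm dvd_trans imageI)
      then obtain L where L: "Lcm (n ` K) = p * L" by (auto elim: dvdE)
      have "n' i dvd L" if "i \<in> K" for i
      proof -
        have *: "n i dvd p * L" using that L by (metis dvd_Lcm imageI)
        show ?thesis
        proof (cases "i \<in> S0")
          case True
          then show ?thesis using * n[of i] p1 by simp
        next
          case False
          then have "coprime (n i) p" using p(1) that
            by (auto simp: S0_def coprime_commute intro: prime_imp_coprime)
          then show ?thesis using * n[of i] False by (simp add: coprime_dvd_mult_right_iff)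
        qed
      qed
      then show ?thesis unfolding L by (intro mult_dvd_mono Lcm_least) auto
    qed
    moreover have "(\<Prod>S\<in>Pow K - {{}}. d' S) dvd p * Lcm (n' ` K)"
      using S0 d(3) assms(1) by (simp add: upd)
    moreover have "n i = venn_prod (Pow K - {{}}) d' i" if "i \<in> K" for i
      using d(2) that S0 assms(1) unfolding venn_prod_def by (simp add: upd n)
    moreover have "d' S > 0" for S using d(1) p1 by (simp add: d'_def)
    ultimately show ?thesis by (intro exI[of _ d']) (meson dvd_trans)
  qed
qed

text \<open>The parameter of the full index set divides every entry, hence their gcd, so it equals 1
  and drops out of all products.\<close>

lemma exists_proper_venn_factorization:
  fixes n :: "'a \<Rightarrow> nat"
  assumes K: "finite K" "K \<noteq> {}" and n: "\<And>i. i \<in> K \<Longrightarrow> n i > 0" and "Gcd (n ` K) = 1"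
  shows "\<exists>d. (\<forall>S. d S > 0) \<and> (\<forall>i\<in>K. n i = venn_prod (proper_parts K) d i)
           \<and> (\<Prod>S\<in>proper_parts K. d S) dvd Lcm (n ` K)"
proof -
  obtain d where d: "\<forall>S. d S > 0" "\<forall>i\<in>K. n i = venn_prod (Pow K - {{}}) d i"
      "(\<Prod>S\<in>Pow K - {{}}. d S) dvd Lcm (n ` K)"
    using exists_venn_factorization[OF K(1), of n] n by auto
  have "d K dvd n i" if "i \<in> K" for i
    using d(2) that K by (auto intro!: dvd_venn_prod)
  then have "d K dvd Gcd (n ` K)" by (auto intro: Gcd_greatest)
  with assms(4) have dK: "d K = 1" by simp
  have eq: "Pow K - {{}} = insert K (proper_parts K)" "K \<notin> proper_parts K"
    using K by (auto simp: proper_parts_def)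
  have "venn_prod (Pow K - {{}}) d i = venn_prod (proper_parts K) d i" for i
    unfolding venn_prod_def eq(1) using dK finite_proper_parts[OF K(1)]
    by (intro prod.mono_neutral_right) auto
  moreover have "(\<Prod>S\<in>Pow K - {{}}. d S) = (\<Prod>S\<in>proper_parts K. d S)"
    unfolding eq(1) using K dK eq(2) by (simp add: finite_proper_parts)
  ultimately show ?thesis using d by auto
qed

text \<open>The difference \<open>harm n - ln n\<close> decreases from its value 1 at
  \<open>n = 1\<close>.\<close>

lemma harm_le_ln_add_1:
  assumes "n > 0"
  shows "harm n \<le> ln (real n) + 1"
  using decseqD[OF decseq_harm_diff_ln, of 0 "n - 1"] assms by (simp add: harm_def)

lemma U_le_harm_power:
  assumes "k > 0"
  shows "U k x \<le> harm (nat \<lfloor>x\<rfloor>) ^ (2 ^ k - 2)"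
proof -
  define K where "K = {1..k}"
  have K: "finite K" "K \<noteq> {}" "card K = k" using assms by (auto simp: K_def)
  define P where "P = proper_parts K"
  have P: "finite P" "card P = 2 ^ k - 2"
    using K by (auto simp: P_def finite_proper_parts card_proper_parts)
  define A where "A = {n. n \<in> pos_tuples_le k x \<and> Gcd (n ` K) = 1}"
  have A: "n i > 0" "real (n i) \<le> x" if "n \<in> A" "i \<in> K" for n i
    using that by (auto simp: A_def pos_tuples_le_def PiE_iff K_def)
  have "\<forall>n\<in>A. \<exists>d. (\<forall>S. d S > 0) \<and> (\<forall>i\<in>K. n i = venn_prod P d i)
           \<and> (\<Prod>S\<in>P. d S) dvd Lcm (n ` K)"
    unfolding P_def using K A by (intro ballI exists_proper_venn_factorization) (auto simp: A_def)
  then obtain d where d: "\<And>n S. n \<in> A \<Longrightarrow> d n S > 0"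
    "\<And>n i. n \<in> A \<Longrightarrow> i \<in> K \<Longrightarrow> n i = venn_prod P (d n) i"
    "\<And>n. n \<in> A \<Longrightarrow> (\<Prod>S\<in>P. d n S) dvd Lcm (n ` K)"
    by metis
  \<comment> \<open>The parameters in \<open>P\<close> determine \<open>n\<close>, so
    \<open>F\<close> is injective; restricting to \<open>P\<close> makes its values extensional, as
    membership in a \<open>PiE\<close> set requires.\<close>
  define F where "F n = restrict (d n) P" for n
  have inj: "inj_on F A"
  proof (rule inj_onI)
    fix n n' assume nn: "n \<in> A" "n' \<in> A" and "F n = F n'"
    then have "d n S = d n' S" if "S \<in> P" for S
      using that by (metis F_def restrict_apply')
    then have "venn_prod P (d n) i = venn_prod P (d n') i" for i
      unfolding venn_prod_def by (intro prod.cong) auto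
    then have "n i = n' i" if "i \<in> K" for i using d(2) nn that by metis
    moreover have "n \<in> K \<rightarrow>\<^sub>E {m. 0 < m \<and> real m \<le> x}" "n' \<in> K \<rightarrow>\<^sub>E {m. 0 < m \<and> real m \<le> x}"
      using nn by (simp_all add: A_def pos_tuples_le_def K_def)
    ultimately show "n = n'" by (intro PiE_ext)
  qed
  have range: "F ` A \<subseteq> P \<rightarrow>\<^sub>E {1..nat \<lfloor>x\<rfloor>}"
  proof (rule image_subsetI, rule PiE_I)
    fix n S assume n: "n \<in> A" and S: "S \<in> P"
    from S obtain i where i: "i \<in> S" "i \<in> K" by (auto simp: P_def proper_parts_def)
    have "d n S dvd n i" using d(2)[OF n i(2)] dvd_venn_prod[OF P(1) S i(1)] by metis
    then have "d n S \<le> n i" using A[OF n i(2)] by (auto intro: dvd_imp_le)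
    then have "d n S \<le> nat \<lfloor>x\<rfloor>" using A[OF n i(2)] by (auto simp: le_nat_floor)
    then show "F n S \<in> {1..nat \<lfloor>x\<rfloor>}" using S d(1)[OF n, of S] by (auto simp: F_def)
  qed (auto simp: F_def)
  have "U k x = (\<Sum>n\<in>A. 1 / real (Lcm (n ` K)))"
    by (simp add: U_def A_def K_def)
  also have "\<dots> \<le> (\<Sum>n\<in>A. \<Prod>S\<in>P. 1 / real (F n S))"
  proof (rule sum_mono)
    fix n assume n: "n \<in> A"
    have "Lcm (n ` K) \<noteq> 0" using A(1)[OF n] K by (force simp: Lcm_0_iff)
    then have "(\<Prod>S\<in>P. d n S) \<le> Lcm (n ` K)" using d(3)[OF n] by (simp add: dvd_imp_le)
    moreover have "(\<Prod>S\<in>P. d n S) > 0" using d(1)[OF n] by (simp add: prod_pos)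
    ultimately have "1 / real (Lcm (n ` K)) \<le> 1 / real (\<Prod>S\<in>P. d n S)"
      by (intro divide_left_mono) (simp_all del: of_nat_prod)
    also have "\<dots> = (\<Prod>S\<in>P. 1 / real (F n S))" by (simp add: F_def prod_dividef)
    finally show "1 / real (Lcm (n ` K)) \<le> (\<Prod>S\<in>P. 1 / real (F n S))" .
  qed
  also have "\<dots> = (\<Sum>g\<in>F ` A. \<Prod>S\<in>P. 1 / real (g S))"
    by (simp add: sum.reindex[OF inj])
  \<comment> \<open>All terms are nonnegative, so the image may be enlarged to all families with
    entries up to \<open>x\<close>; the sum then factors into one harmonic sum per set in
    \<open>P\<close>.\<close>
  also have "\<dots> \<le> (\<Sum>g\<in>P \<rightarrow>\<^sub>E {1..nat \<lfloor>x\<rfloor>}. \<Prod>S\<in>P. 1 / real (g S))"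
    using P by (intro sum_mono2 range finite_PiE) (auto intro: prod_nonneg)
  also have "\<dots> = (\<Prod>S\<in>P. \<Sum>a\<in>{1..nat \<lfloor>x\<rfloor>}. 1 / real a)"
    using P by (intro prod_sum_PiE[symmetric]) auto
  also have "\<dots> = harm (nat \<lfloor>x\<rfloor>) ^ (2 ^ k - 2)"
    using P by (simp add: harm_def inverse_eq_divide)
  finally show ?thesis .
qed

text \<open>From \<open>exp 1\<close> on, \<open>ln x + 1\<close> is at most
  \<open>2 * ln x\<close>, which is the source of the constant.\<close>

lemma U_le_ln_power:
  assumes "k > 0" "x \<ge> exp 1"
  shows "U k x \<le> 2 ^ (2 ^ k - 2) * ln x ^ (2 ^ k - 2)"
proof -
  have x: "x \<ge> 1" "x > 0" using assms(2) exp_ge_add_one_self[of 1] by linarith+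
  have "ln x \<ge> 1" using assms(2) x by (simp add: ln_ge_iff)
  have N: "nat \<lfloor>x\<rfloor> > 0" "real (nat \<lfloor>x\<rfloor>) \<le> x" using x by auto
  then have "ln (real (nat \<lfloor>x\<rfloor>)) \<le> ln x" using x by simp
  then have "harm (nat \<lfloor>x\<rfloor>) \<le> 2 * ln x"
    using harm_le_ln_add_1[OF N(1)] \<open>ln x \<ge> 1\<close> by linarith
  then have "harm (nat \<lfloor>x\<rfloor>) ^ (2 ^ k - 2) \<le> (2 * ln x) ^ (2 ^ k - 2)"
    by (intro power_mono harm_nonneg)
  then show ?thesis using U_le_harm_power[OF assms(1), of x] by (simp add: power_mult_distrib)
qed

subsection \<open>Lower bound\<close>


text \<open>A union bound for weights: the sets may overlap. It serves to bound the families in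
  which some two entries share a factor.\<close>

lemma sum_UN_le:
  fixes f :: "'a \<Rightarrow> real"
  assumes "finite I" "\<And>i. i \<in> I \<Longrightarrow> finite (A i)" "\<And>x. f x \<ge> 0"
  shows "sum f (\<Union>i\<in>I. A i) \<le> (\<Sum>i\<in>I. sum f (A i))"
  using assms(1,2)
proof (induction I rule: finite_induct)
  case (insert i I)
  have "sum f (A i \<union> (\<Union>i\<in>I. A i)) = sum f (A i) + sum f (\<Union>i\<in>I. A i) - sum f (A i \<inter> (\<Union>i\<in>I. A i))"
    using insert by (intro sum_Un) auto
  also have "\<dots> \<le> sum f (A i) + sum f (\<Union>i\<in>I. A i)"
    using assms(3) by (simp add: sum_nonneg)
  finally show ?case using insert by fastforce
qed simp

text \<open>Telescoping, with \<open>1/n^2\<close> at most \<open>1/(n-1) - 1/n\<close>.\<close>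

lemma sum_inverse_squares_tail_le:
  assumes "R > 0"
  shows "(\<Sum>n\<in>{R<..M}. 1 / real n ^ 2) \<le> 1 / real R"
proof (cases "R \<le> M")
  case True
  have "(\<Sum>n\<in>{R<..M}. 1 / real n ^ 2) \<le> 1 / real R - 1 / real M"
    using True
  proof (induction M rule: dec_induct)
    case (step M)
    have "1 / real (Suc M) ^ 2 \<le> 1 / (real M * real (Suc M))"
      using step assms by (intro divide_left_mono) (auto simp: power2_eq_square mult_right_mono)
    also have "\<dots> = 1 / real M - 1 / real (Suc M)"
      using step assms by (simp add: field_simps)
    finally have "1 / real (Suc M) ^ 2 \<le> 1 / real M - 1 / real (Suc M)" .
    moreover have "{R<..Suc M} = insert (Suc M) {R<..M}" using step by auto
    ultimately show ?case using step by simp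
  qed simp
  also have "\<dots> \<le> 1 / real R" by simp
  finally show ?thesis .
qed simp

section \<open>Pairwise coprime families yield distinct admissible tuples\<close>

definition pairwise_coprime_on :: "'a set \<Rightarrow> ('a \<Rightarrow> nat) \<Rightarrow> bool" where
  "pairwise_coprime_on P g \<longleftrightarrow> pairwise (\<lambda>S T. coprime (g S) (g T)) P"

text \<open>By coprimality \<open>S\<close> is the only set in \<open>P\<close> whose value
  \<open>p\<close> divides. Hence \<open>S\<close> can be read off from the tuple through the
  indices whose entries \<open>p\<close> divides; injectivity and the gcd condition both rest on
  this.\<close>

lemma prime_dvd_venn_prod_iff_mem:
  assumes "finite P" "pairwise_coprime_on P g" "prime p" "S \<in> P" "p dvd g S"
  shows "p dvd venn_prod P g i \<longleftrightarrow> i \<in> S"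
proof -
  have "T = S" if "T \<in> P" "p dvd g T" for T
    using assms that unfolding pairwise_coprime_on_def pairwise_def
    by (metis coprime_common_divisor not_prime_unit)
  then show ?thesis using prime_dvd_venn_prod[OF assms(1,3), of g i] assms(4,5) by blast
qed

text \<open>For \<open>i\<close> in \<open>S\<close>, \<open>g S\<close> divides the common entry at
  \<open>i\<close>, which is a product of values of \<open>h\<close>. It is coprime to all of these
  except \<open>h S\<close>, so it divides \<open>h S\<close>. Exchanging \<open>g\<close> and
  \<open>h\<close> later gives equality.\<close>

lemma venn_prod_inject_dvd:
  assumes P: "finite P" "P \<subseteq> Pow K - {{}}"
    and g: "pairwise_coprime_on P g" and h: "pairwise_coprime_on P h"
    and eq: "\<And>i. i \<in> K \<Longrightarrow> venn_prod P g i = venn_prod P h i"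
    and S: "S \<in> P"
  shows "g S dvd h S"
proof -
  obtain i where i: "i \<in> S" "i \<in> K" using P S by fast
  have cop: "coprime (g S) (h T)" if T: "T \<in> P" "T \<noteq> S" for T
  proof (rule ccontr)
    assume "\<not> coprime (g S) (h T)"
    then obtain p where p: "prime p" "p dvd g S" "p dvd h T"
      using prime_factor_nat[of "gcd (g S) (h T)"] by (auto simp: coprime_iff_gcd_eq_1)
    \<comment> \<open>Both \<open>S\<close> and \<open>T\<close> consist of the indices in
      \<open>K\<close> whose entry is divisible by \<open>p\<close>, which forces
      \<open>S = T\<close>.\<close>
    have "j \<in> S \<longleftrightarrow> j \<in> T" if "j \<in> K" for j
      using prime_dvd_venn_prod_iff_mem[OF P(1) g p(1) S p(2), of j]
        prime_dvd_venn_prod_iff_mem[OF P(1) h p(1) T(1) p(3), of j] eq[OF that] by simp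
    then show False using P S T by blast
  qed
  have "{T. T \<in> P \<and> i \<in> T} = insert S {T. T \<in> P \<and> i \<in> T \<and> T \<noteq> S}"
    using S i by auto
  then have "venn_prod P h i = h S * (\<Prod>T | T \<in> P \<and> i \<in> T \<and> T \<noteq> S. h T)"
    unfolding venn_prod_def using P(1) by simp
  moreover have "coprime (g S) (\<Prod>T | T \<in> P \<and> i \<in> T \<and> T \<noteq> S. h T)"
    using cop by (intro prod_coprime_right) auto
  moreover have "g S dvd venn_prod P h i"
    using dvd_venn_prod[OF P(1) S i(1), of g] eq[OF i(2)] by simp
  ultimately show ?thesis by (simp add: coprime_dvd_mult_left_iff)
qed

lemma inj_on_restrict_venn_prod:
  assumes "finite P" "P \<subseteq> Pow K - {{}}"
  shows "inj_on (\<lambda>g. restrict (venn_prod P g) K) {g \<in> P \<rightarrow>\<^sub>E D. pairwise_coprime_on P g}"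
proof (rule inj_onI, clarify)
  fix g h assume gh: "g \<in> P \<rightarrow>\<^sub>E D" "h \<in> P \<rightarrow>\<^sub>E D" "pairwise_coprime_on P g" "pairwise_coprime_on P h"
    and eq: "restrict (venn_prod P g) K = restrict (venn_prod P h) K"
  have eq': "venn_prod P g i = venn_prod P h i" if "i \<in> K" for i
    using fun_cong[OF eq, of i] that by simp
  have "g S = h S" if "S \<in> P" for S
    using venn_prod_inject_dvd[OF assms gh(3,4) eq' that]
      venn_prod_inject_dvd[OF assms gh(4,3) eq'[symmetric] that] by (rule dvd_antisym)
  then show "g = h" using gh(1,2) by (intro PiE_ext)
qed

text \<open>A prime dividing all entries divides some \<open>g S\<close>, and then every index lies
  in \<open>S\<close>; but \<open>K\<close> itself is not a proper part.\<close>

lemma Gcd_venn_prod: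
  assumes "finite K" "P = proper_parts K" "pairwise_coprime_on P g" "K \<noteq> {}"
  shows "Gcd (venn_prod P g ` K) = 1"
proof (rule ccontr)
  assume "Gcd (venn_prod P g ` K) \<noteq> 1"
  then obtain p where p: "prime p" "p dvd Gcd (venn_prod P g ` K)"
    using prime_factor_nat by blast
  have P: "finite P" using assms by (simp add: finite_proper_parts)
  have dvd: "p dvd venn_prod P g i" if "i \<in> K" for i
    using p(2) that by (meson Gcd_dvd dvd_trans imageI)
  obtain i where i: "i \<in> K" using assms by auto
  from dvd[OF i] obtain S where S: "S \<in> P" "p dvd g S"
    using prime_dvd_venn_prod[OF P p(1)] by blast
  have "K \<subseteq> S" using prime_dvd_venn_prod_iff_mem[OF P assms(3) p(1) S] dvd by auto
  then show False using S(1) assms(2) by (auto simp: proper_parts_def)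
qed

lemma Lcm_venn_prod_le:
  assumes "finite P" "\<And>S. S \<in> P \<Longrightarrow> g S > 0"
  shows "Lcm (venn_prod P g ` K) \<le> (\<Prod>S\<in>P. g S)"
proof (rule dvd_imp_le)
  show "Lcm (venn_prod P g ` K) dvd (\<Prod>S\<in>P. g S)"
    unfolding venn_prod_def using assms(1) by (intro Lcm_least) (auto intro!: prod_dvd_prod_subset)
qed (use assms in \<open>auto intro: prod_pos\<close>)

text \<open>The tuples built from pairwise coprime families form a subset of those summed in
  \<open>U\<close>. Each entry divides the product of all parameters, hence is at most
  \<open>M ^ (2 ^ k - 2)\<close>, which explains the bound on \<open>M\<close>.\<close>

lemma sum_pairwise_coprime_le_U:
  assumes "k > 0" "real M ^ (2 ^ k - 2) \<le> x" "D \<subseteq> {1..M}"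
  defines "P \<equiv> proper_parts {1..k}"
  shows "(\<Sum>g | g \<in> P \<rightarrow>\<^sub>E D \<and> pairwise_coprime_on P g. \<Prod>S\<in>P. 1 / real (g S)) \<le> U k x"
proof -
  define K where "K = {1..k}"
  have K: "finite K" "K \<noteq> {}" "card K = k" using assms by (auto simp: K_def)
  have P: "finite P" "card P = 2 ^ k - 2" "P \<subseteq> Pow K - {{}}"
    using K unfolding P_def K_def[symmetric]
    by (auto simp: finite_proper_parts card_proper_parts) (auto simp: proper_parts_def)
  define C where "C = {g \<in> P \<rightarrow>\<^sub>E D. pairwise_coprime_on P g}"
  define \<Phi> where "\<Phi> g = restrict (venn_prod P g) K" for g
  have im: "\<Phi> g ` K = venn_prod P g ` K" for g by (auto simp: \<Phi>_def)
  have gD: "g S > 0" "g S \<le> M" if "g \<in> C" "S \<in> P" for g S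
  proof -
    have "g S \<in> D" using that by (auto simp: C_def)
    then show "g S > 0" "g S \<le> M" using assms(3) by auto
  qed
  have pos: "venn_prod P g i > 0" if "g \<in> C" for g i
    unfolding venn_prod_def using gD[OF that] by (auto intro!: prod_pos)
  have inj: "inj_on \<Phi> C"
    unfolding \<Phi>_def C_def by (intro inj_on_restrict_venn_prod P)
  have sub: "\<Phi> ` C \<subseteq> {n. n \<in> pos_tuples_le k x \<and> Gcd (n ` {1..k}) = 1}"
  proof (rule image_subsetI, rule CollectI, rule conjI)
    fix g assume g: "g \<in> C"
    have "venn_prod P g i > 0 \<and> real (venn_prod P g i) \<le> x" if "i \<in> K" for i
    proof
      show "venn_prod P g i > 0" using pos[OF g] .
      have "venn_prod P g i \<le> (\<Prod>S\<in>P. g S)"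
        unfolding venn_prod_def using gD[OF g] P(1)
        by (intro dvd_imp_le prod_dvd_prod_subset) (auto intro!: prod_pos)
      also have "\<dots> \<le> (\<Prod>S\<in>P. M)" using gD[OF g] by (intro prod_mono) auto
      finally have "venn_prod P g i \<le> M ^ (2 ^ k - 2)" using P(2) by simp
      then show "real (venn_prod P g i) \<le> x"
        using assms(2) by (metis of_nat_le_iff of_nat_power order_trans)
    qed
    then show "\<Phi> g \<in> pos_tuples_le k x"
      unfolding pos_tuples_le_def K_def[symmetric] \<Phi>_def by (intro restrict_PiE_iff[THEN iffD2]) auto
    show "Gcd (\<Phi> g ` {1..k}) = 1"
      using Gcd_venn_prod[OF K(1) _ _ K(2), of P g] g im by (simp add: C_def P_def K_def)
  qed
  have "(\<Sum>g\<in>C. \<Prod>S\<in>P. 1 / real (g S)) \<le> (\<Sum>g\<in>C. 1 / real (Lcm (\<Phi> g ` K)))"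
  proof (rule sum_mono)
    fix g assume g: "g \<in> C"
    have "0 \<notin> venn_prod P g ` K" using pos[OF g] by (metis imageE less_irrefl)
    then have "Lcm (venn_prod P g ` K) \<noteq> 0" using K(1) by (simp add: Lcm_0_iff)
    then have "1 / real (\<Prod>S\<in>P. g S) \<le> 1 / real (Lcm (venn_prod P g ` K))"
      using Lcm_venn_prod_le[OF P(1), of g K] gD[OF g]
      by (intro divide_left_mono) (auto simp del: of_nat_prod intro!: mult_pos_pos prod_pos)
    then show "(\<Prod>S\<in>P. 1 / real (g S)) \<le> 1 / real (Lcm (\<Phi> g ` K))"
      by (simp add: im prod_dividef)
  qed
  also have "\<dots> = (\<Sum>n\<in>\<Phi> ` C. 1 / real (Lcm (n ` K)))"
    by (simp add: sum.reindex[OF inj])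
  also have "\<dots> \<le> U k x"
    unfolding U_def K_def
    by (intro sum_mono2 sub) (auto intro: finite_subset[OF _ finite_pos_tuples_le])
  finally show ?thesis by (simp add: C_def)
qed


section \<open>Reciprocal sums over families of integers coprime to a factorial\<close>

lemma gt_if_dvd_coprime_fact:
  assumes "coprime a (fact R)" "n dvd a" "n \<noteq> (1::nat)" "n > 0"
  shows "n > R"
proof (rule ccontr)
  assume "\<not> n > R"
  then have "n dvd fact R" using assms(4) by (intro dvd_fact) auto
  then show False using assms(1-3) by (metis coprime_common_divisor nat_dvd_1_iff_1)
qed

text \<open>\<open>D\<close> is closed under divisors, so dividing by \<open>n\<close> sends its
  multiples of \<open>n\<close> back into \<open>D\<close> and extracts a factor
  \<open>1/n\<close>.\<close>

lemma sum_coprime_multiples_le: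
  fixes Q :: nat
  assumes "D = {d \<in> {1..M}. coprime d Q}" "n > 0"
  shows "(\<Sum>d | d \<in> D \<and> n dvd d. 1 / real d) \<le> (\<Sum>d\<in>D. 1 / real d) / real n"
proof -
  have "{d. d \<in> D \<and> n dvd d} \<subseteq> (*) n ` D"
  proof (clarify, elim dvdE)
    fix d e assume d: "d \<in> D" "d = n * e"
    then have "e \<in> D" using assms by (auto simp: intro: order_trans[of e "n * e"])
    then show "d \<in> (*) n ` D" using d by auto
  qed
  then have "(\<Sum>d | d \<in> D \<and> n dvd d. 1 / real d) \<le> (\<Sum>d\<in>(*) n ` D. 1 / real d)"
    using assms(1) by (intro sum_mono2) auto
  also have "\<dots> = (\<Sum>d\<in>D. 1 / real (n * d))"
    using assms(2) by (subst sum.reindex) (auto simp: inj_on_def)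
  also have "\<dots> = (\<Sum>d\<in>D. 1 / real d) / real n"
    by (simp add: sum_divide_distrib mult.commute)
  finally show ?thesis .
qed

text \<open>The conditions restrict the coordinates independently, so the sum factors: the
  coordinates \<open>S\<close> and \<open>S'\<close> each gain a factor \<open>1/n\<close>, and all
  others contribute \<open>T\<close>.\<close>

lemma sum_PiE_common_divisor_le:
  fixes Q :: nat
  assumes D: "D = {d \<in> {1..M}. coprime d Q}" and n: "n > 0"
    and P: "finite P" "S \<in> P" "S' \<in> P" "S \<noteq> S'"
  defines "T \<equiv> \<Sum>d\<in>D. 1 / real d"
  shows "(\<Sum>g | g \<in> P \<rightarrow>\<^sub>E D \<and> n dvd g S \<and> n dvd g S'. \<Prod>R\<in>P. 1 / real (g R))
           \<le> T ^ card P * (1 / real n ^ 2)"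
proof -
  define E where "E R = (if R = S \<or> R = S' then {d. d \<in> D \<and> n dvd d} else D)" for R
  have fin: "finite D" using D by simp
  have set_eq: "{g. g \<in> P \<rightarrow>\<^sub>E D \<and> n dvd g S \<and> n dvd g S'} = PiE P E"
  proof -
    have "(\<forall>R\<in>P. g R \<in> E R) \<longleftrightarrow> (\<forall>R\<in>P. g R \<in> D) \<and> n dvd g S \<and> n dvd g S'" for g
      using P by (auto simp: E_def)
    then show ?thesis unfolding set_eq_iff mem_Collect_eq PiE_iff by blast
  qed
  have T: "T \<ge> 0" by (simp add: T_def sum_nonneg)
  have "(\<Sum>g\<in>PiE P E. \<Prod>R\<in>P. 1 / real (g R)) = (\<Prod>R\<in>P. \<Sum>d\<in>E R. 1 / real d)"
    using P fin by (intro prod_sum_PiE[symmetric]) (auto simp: E_def)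
  also have "\<dots> \<le> (\<Prod>R\<in>P. T * (if R \<in> {S, S'} then 1 / real n else 1))"
  proof (intro prod_mono conjI)
    show "(\<Sum>d\<in>E R. 1 / real d) \<le> T * (if R \<in> {S, S'} then 1 / real n else 1)" for R
      using sum_coprime_multiples_le[OF D n] by (simp add: E_def T_def)
  qed (simp add: sum_nonneg)
  also have "\<dots> = T ^ card P * (\<Prod>R\<in>P. if R \<in> {S, S'} then 1 / real n else 1)"
    by (simp add: prod.distrib)
  also have "(\<Prod>R\<in>P. if R \<in> {S, S'} then 1 / real n else 1) = (\<Prod>R\<in>{S, S'}. 1 / real n)"
    using P by (intro prod.mono_neutral_cong_right) auto
  finally show ?thesis using P(4) by (simp add: set_eq power2_eq_square)
qed

lemma half_le_sum_pairwise_coprime: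
  fixes M :: nat
  assumes P: "finite P" "P \<noteq> {}" and D: "D = {d \<in> {1..M}. coprime d (fact (2 * card P ^ 2))}"
  defines "T \<equiv> \<Sum>d\<in>D. 1 / real d"
  shows "T ^ card P / 2 \<le> (\<Sum>g | g \<in> P \<rightarrow>\<^sub>E D \<and> pairwise_coprime_on P g. \<Prod>S\<in>P. 1 / real (g S))"
proof -
  define R where "R = 2 * card P ^ 2"
  define w where "w g = (\<Prod>S\<in>P. 1 / real (g S))" for g
  define A where "A = P \<rightarrow>\<^sub>E D"
  define C where "C = {g. g \<in> A \<and> pairwise_coprime_on P g}"
  \<comment> \<open>\<open>I\<close> lists the ways to fail coprimality: an ordered pair of distinct
    sets and a common factor \<open>n\<close> of their values. Coprimality to \<open>fact R\<close>
    forces \<open>n > R\<close>, which leaves only the small tail of \<open>1/n^2\<close>.\<close>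
  define I where "I = {(S, S'). S \<in> P \<and> S' \<in> P \<and> S \<noteq> S'} \<times> {R<..M}"
  define B where "B = (\<lambda>((S, S'), n). {g. g \<in> A \<and> n dvd g S \<and> n dvd g S'})"
  have card: "card P > 0" using P by (simp add: card_gt_0_iff)
  have finD: "finite D" using D by simp
  have finA: "finite A" using P finD by (auto simp: A_def intro: finite_PiE)
  have w0: "w g \<ge> 0" for g by (simp add: w_def prod_nonneg)
  have T: "T \<ge> 0" by (simp add: T_def sum_nonneg)
  have sub: "{(S, S'). S \<in> P \<and> S' \<in> P \<and> S \<noteq> S'} \<subseteq> P \<times> P" by auto
  have finI: "finite I" unfolding I_def using finite_subset[OF sub] P by auto
  have finB: "finite (B i)" for i
    using finA by (auto simp: B_def split: prod.split)
  have "A - C \<subseteq> (\<Union>i\<in>I. B i)"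
  proof
    fix g assume "g \<in> A - C"
    then obtain S S' where g: "g \<in> A" and S: "S \<in> P" "S' \<in> P" "S \<noteq> S'" "\<not> coprime (g S) (g S')"
      by (auto simp: C_def pairwise_coprime_on_def pairwise_def)
    define n where "n = gcd (g S) (g S')"
    have gS: "g S \<in> D" using g S by (auto simp: A_def)
    then have gS': "g S > 0" "g S \<le> M" "coprime (g S) (fact R)" by (auto simp: D R_def)
    have n: "n > 0" "n \<noteq> 1" "n dvd g S" "n dvd g S'"
      using gS' S(4) by (auto simp: n_def coprime_iff_gcd_eq_1)
    have "n > R" using gt_if_dvd_coprime_fact[OF gS'(3) n(3,2,1)] .
    moreover have "n \<le> M" using dvd_imp_le[OF n(3) gS'(1)] gS'(2) by simp
    ultimately have "((S, S'), n) \<in> I" using S by (auto simp: I_def)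
    moreover have "g \<in> B ((S, S'), n)" using g n by (auto simp: B_def)
    ultimately show "g \<in> (\<Union>i\<in>I. B i)" by blast
  qed
  then have "sum w (A - C) \<le> sum w (\<Union>i\<in>I. B i)"
    using finI finB w0 by (intro sum_mono2) auto
  also have "\<dots> \<le> (\<Sum>i\<in>I. sum w (B i))"
    by (intro sum_UN_le finI finB w0)
  also have "\<dots> \<le> (\<Sum>i\<in>I. T ^ card P * (1 / real (snd i) ^ 2))"
  proof (rule sum_mono)
    fix i assume "i \<in> I"
    then obtain S S' n where i: "i = ((S, S'), n)" "S \<in> P" "S' \<in> P" "S \<noteq> S'" "n > 0"
      by (auto simp: I_def)
    show "sum w (B i) \<le> T ^ card P * (1 / real (snd i) ^ 2)"
      using sum_PiE_common_divisor_le[OF D i(5) P(1) i(2-4)]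
      by (simp add: B_def i(1) w_def T_def A_def)
  qed
  also have "\<dots> = (\<Sum>_\<in>{(S, S'). S \<in> P \<and> S' \<in> P \<and> S \<noteq> S'}. T ^ card P * (\<Sum>n\<in>{R<..M}. 1 / real n ^ 2))"
    unfolding I_def sum_distrib_left sum.cartesian_product by (simp add: split_def)
  also have "\<dots> = real (card {(S, S'). S \<in> P \<and> S' \<in> P \<and> S \<noteq> S'}) * (T ^ card P * (\<Sum>n\<in>{R<..M}. 1 / real n ^ 2))"
    by simp
  also have "\<dots> \<le> real (card P ^ 2) * (T ^ card P * (1 / real R))"
  proof (intro mult_mono mult_left_mono)
    show "real (card {(S, S'). S \<in> P \<and> S' \<in> P \<and> S \<noteq> S'}) \<le> real (card P ^ 2)"
      using card_mono[OF _ sub] P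
      by (simp only: of_nat_le_iff) (simp add: card_cartesian_product power2_eq_square)
    show "(\<Sum>n\<in>{R<..M}. 1 / real n ^ 2) \<le> 1 / real R"
      using card by (intro sum_inverse_squares_tail_le) (simp add: R_def)
  qed (use T in \<open>auto intro!: sum_nonneg mult_nonneg_nonneg\<close>)
  also have "\<dots> = T ^ card P / 2" using card by (simp add: R_def field_simps)
  finally have "sum w (A - C) \<le> T ^ card P / 2" .
  moreover have "sum w (A - C) = sum w A - sum w C"
    using finA by (intro sum_diff) (auto simp: C_def)
  moreover have "sum w A = T ^ card P"
    unfolding w_def A_def T_def using P finD by (subst prod_sum_PiE[symmetric]) auto
  ultimately show ?thesis by (simp add: w_def A_def C_def)
qed

lemma ln_le_sum_coprime:
  assumes "Q > 0"
  shows "(ln (real (M + 1)) - ln (real Q)) / real Q \<le> (\<Sum>d | d \<in> {1..M} \<and> coprime d Q. 1 / real d)"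
\<comment> \<open>For \<open>M = 0\<close> the sum is empty and the left side is nonpositive;
  afterwards the natural subtraction \<open>M - 1\<close> is a true one.\<close>
proof (cases "M = 0")
  case True
  then show ?thesis using assms by simp
next
  case False
  \<comment> \<open>The largest \<open>j\<close> with \<open>1 + j * Q\<close> at most
    \<open>M\<close>, so the progression has \<open>J + 1\<close> terms in range.\<close>
  define J where "J = (M - 1) div Q"
  have JM: "J * Q \<le> M - 1" by (simp add: J_def)
  have "M - 1 < (J + 1) * Q" unfolding J_def using assms
    using dividend_less_div_times[of Q "M - 1"] by (simp add: add.commute)
  then have "M + 1 \<le> (J + 2) * Q" using assms False by (simp add: algebra_simps)
  then have "real (M + 1) \<le> real (J + 2) * real Q" by (simp only: of_nat_le_iff of_nat_mult[symmetric])
  then have le: "real (M + 1) / real Q \<le> real (J + 2)"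
    using assms by (simp only: pos_divide_le_eq of_nat_0_less_iff)
  txt \<open>It suffices to count the \<open>d \<equiv> 1\<close> modulo \<open>Q\<close>.\<close>
  have "(ln (real (M + 1)) - ln (real Q)) / real Q = ln (real (M + 1) / real Q) / real Q"
    using assms by (simp add: ln_div)
  also have "\<dots> \<le> harm (J + 1) / real Q"
  proof (rule divide_right_mono)
    have "ln (real (M + 1) / real Q) \<le> ln (real (J + 2))"
      using le assms by (intro ln_mono) auto
    also have "\<dots> \<le> harm (J + 1)" using ln_le_harm[of "J + 1"] by (simp add: add.commute)
    finally show "ln (real (M + 1) / real Q) \<le> harm (J + 1)" .
  qed simp
  also have "\<dots> = (\<Sum>j<J + 1. 1 / (real Q * real (Suc j)))"
    by (simp add: harm_altdef sum_divide_distrib inverse_eq_divide mult.commute del: sum.lessThan_Suc)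
  \<comment> \<open>Since \<open>Q\<close> is at least 1, \<open>1 + j * Q\<close> is at most
    \<open>Q * (j + 1)\<close>, so the progression dominates the harmonic sum scaled by
    \<open>1/Q\<close>.\<close>
  also have "\<dots> \<le> (\<Sum>j<J + 1. 1 / real (1 + j * Q))"
  proof (intro sum_mono divide_left_mono)
    fix j
    have "1 + j * Q \<le> Q * Suc j" using assms by (simp add: algebra_simps)
    then show "real (1 + j * Q) \<le> real Q * real (Suc j)" by (metis of_nat_le_iff of_nat_mult)
  qed (use assms in \<open>auto intro!: mult_pos_pos add_pos_nonneg\<close>)
  also have "\<dots> = (\<Sum>d\<in>(\<lambda>j. 1 + j * Q) ` {..<J + 1}. 1 / real d)"
    using assms by (subst sum.reindex) (auto simp: inj_on_def)
  also have "\<dots> \<le> (\<Sum>d | d \<in> {1..M} \<and> coprime d Q. 1 / real d)"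
  proof (rule sum_mono2)
    show "(\<lambda>j. 1 + j * Q) ` {..<J + 1} \<subseteq> {d. d \<in> {1..M} \<and> coprime d Q}"
    proof (rule image_subsetI)
      fix j assume "j \<in> {..<J + 1}"
      then have "j * Q \<le> J * Q" by simp
      then have "1 + j * Q \<le> M" using JM False by linarith
      moreover have "coprime (1 + j * Q) Q"
        by (metis coprime_1_left coprime_iff_gcd_eq_1 gcd.commute gcd_add_mult mult.commute add.commute)
      ultimately show "1 + j * Q \<in> {d. d \<in> {1..M} \<and> coprime d Q}" by simp
    qed
  qed auto
  finally show ?thesis .
qed

section \<open>Choice of the cutoff and of the constants\<close>

lemma ln_power_le_U:
  assumes "k \<ge> 2"
  defines "m \<equiv> 2 ^ k - (2::nat)"
  defines "Q \<equiv> (fact (2 * m ^ 2) :: nat)"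
  assumes x: "x \<ge> 1" "ln x \<ge> 2 * real m * ln (real Q)"
  shows "(1 / (2 * real m * real Q)) ^ m / 2 * ln x ^ m \<le> U k x"
proof -
  define P where "P = proper_parts {1..k}"
  have "(2::nat) ^ 2 \<le> 2 ^ k" using assms(1) by (intro power_increasing) auto
  then have m: "m > 0" unfolding m_def by simp
  have P: "finite P" "card P = m"
    using assms(1) by (auto simp: P_def m_def finite_proper_parts card_proper_parts)
  \<comment> \<open>The largest cutoff with \<open>M ^ m\<close> at most \<open>x\<close>; its
    logarithm is still essentially \<open>ln x / m\<close>.\<close>
  define M where "M = nat \<lfloor>root m x\<rfloor>"
  have r: "root m x \<ge> 1" using x m by simp
  then have M: "real M \<le> root m x" "root m x \<le> real (M + 1)" unfolding M_def by linarith+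
  have "real M ^ m \<le> root m x ^ m" using M by (intro power_mono) auto
  then have Mx: "real M ^ m \<le> x" using m x by simp
  define D where "D = {d \<in> {1..M}. coprime d Q}"
  define T where "T = (\<Sum>d\<in>D. 1 / real d)"
  have Q: "Q > 0" by (simp add: Q_def)
  have "ln (root m x) \<le> ln (real (M + 1))" using M r by (intro ln_mono) auto
  moreover have "ln (root m x) = ln x / real m" using m x by (simp add: ln_root)
  \<comment> \<open>The threshold on \<open>ln x\<close> makes \<open>ln Q\<close> at most half of
    \<open>ln x / m\<close>, so the other half survives as a lower bound for the difference of
    logarithms.\<close>
  moreover have "ln x / (2 * real m) \<ge> ln (real Q)" using x(2) m by (simp add: field_simps)
  moreover have "ln x / real m = ln x / (2 * real m) + ln x / (2 * real m)" by simp
  ultimately have "ln x / (2 * real m) \<le> ln (real (M + 1)) - ln (real Q)" by linarith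
  then have "ln x / (2 * real m) / real Q \<le> (ln (real (M + 1)) - ln (real Q)) / real Q"
    by (intro divide_right_mono) auto
  also have "\<dots> \<le> T" using ln_le_sum_coprime[OF Q, of M] by (simp add: T_def D_def)
  finally have "1 / (2 * real m * real Q) * ln x \<le> T" by simp
  then have "(1 / (2 * real m * real Q) * ln x) ^ m \<le> T ^ m"
    using x by (intro power_mono) auto
  then have "(1 / (2 * real m * real Q)) ^ m / 2 * ln x ^ m \<le> T ^ m / 2"
    by (simp add: power_mult_distrib power_divide)
  also have "\<dots> \<le> (\<Sum>g | g \<in> P \<rightarrow>\<^sub>E D \<and> pairwise_coprime_on P g. \<Prod>S\<in>P. 1 / real (g S))"
  proof -
    have "P \<noteq> {}" using P m by auto
    from half_le_sum_pairwise_coprime[OF P(1) this, of D M] show ?thesis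
      by (simp add: T_def D_def Q_def P(2))
  qed
  also have "\<dots> \<le> U k x"
    unfolding P_def
  proof (rule sum_pairwise_coprime_le_U)
    show "real M ^ (2 ^ k - 2) \<le> x" using Mx by (simp add: m_def)
  qed (use assms(1) in \<open>auto simp: D_def\<close>)
  finally show ?thesis .
qed

theorem theorem4:
  fixes k :: nat
  assumes "k \<ge> 3"
  shows "\<exists>c1 c2 :: real. c1 > 0 \<and> c2 > 0 \<and>
    (\<forall>\<^sub>F x :: real in at_top.
       c1 * ln x ^ (2 ^ k - 2) \<le> U k x \<and> U k x \<le> c2 * ln x ^ (2 ^ k - 2))"
proof -
  define m where "m = 2 ^ k - (2::nat)"
  define Q where "Q = (fact (2 * m ^ 2) :: nat)"
  define c1 where "c1 = (1 / (2 * real m * real Q)) ^ m / 2"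
  have "(2::nat) ^ 3 \<le> 2 ^ k" using assms by (intro power_increasing) auto
  then have "m > 0" by (simp add: m_def)
  then have "c1 > 0" by (simp add: c1_def Q_def)
  \<comment> \<open>One threshold for both bounds: the 1 gives \<open>x\<close> at least
    \<open>exp 1\<close> for the upper bound, the other term is the condition of
    \<open>ln_power_le_U\<close>.\<close>
  moreover have "\<forall>\<^sub>F x :: real in at_top. x \<ge> exp (max 1 (2 * real m * ln (real Q)))"
    by (rule eventually_ge_at_top)
  then have "\<forall>\<^sub>F x :: real in at_top.
      c1 * ln x ^ (2 ^ k - 2) \<le> U k x \<and> U k x \<le> 2 ^ m * ln x ^ (2 ^ k - 2)"
  proof eventually_elim
    case (elim x)
    then have "x > 0" by (meson exp_gt_zero less_le_trans)
    with elim have ln: "ln x \<ge> max 1 (2 * real m * ln (real Q))" by (simp only: ln_ge_iff)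
    then have x: "x \<ge> exp 1" using \<open>x > 0\<close> by (simp add: ln_ge_iff)
    then have "x \<ge> 1" using exp_ge_add_one_self[of 1] by linarith
    then show ?case
      using ln_power_le_U[of k x] U_le_ln_power[of k x] ln x assms
      by (simp add: c1_def m_def Q_def)
  qed
  ultimately show ?thesis by (intro exI[of _ c1] exI[of _ "2 ^ m"]) simp
qed

end
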